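(* The operator $\mathcal{L}_g^s$ is strictly T-monotone in $W^{s,G_{:}}_0(\Omega)$, i.e. $$\langle\mathcal{L}_g^su-\mathcal{L}_g^sv,(u-v)^+\rangle>0\qquad\text{for all }u,v\in W^{s,G_{:}}_0(\Omega)\text{ with }(u-v)^+\neq0.$$
   Context: Setting. Let $0<s<1$ and let $\Omega\subset\mathbb{R}^d$ be a bounded domain with Lipschitz boundary. Let $g=g(x,y,r):\mathbb{R}^d\times\mathbb{R}^d\times\mathbb{R}^+\to\mathbb{R}^+$ be a positive measurable function, Lipschitz continuous in $r$, such that for a.e. $x,y$: $\lim_{r\to0^+}rg(x,y,r)=0$, $\lim_{r\to+\infty}rg(x,y,r)=+\infty$, and, with $g'=\partial_r g$, $$0<g_*\le \frac{r g'(x,y,r)}{g(x,y,r)}+1\le g^*\quad\text{for } r>0,$$ for constants $0<g_*\le g^*$. Put $\bar g(x,y,r)=rg(x,y,r)$, $G_{:}=G(x,y,r)=\int_0^r\bar g(x,y,\rho)\,d\rho$ and $\hat G_\cdot(r)=G(x,x,r)$. Set $\delta^s u(x,y)=\frac{u(x)-u(y)}{|x-y|^s}$. Spaces. $\Gamma_{\hat G_\cdot}(u)=\int_{\mathbb{R}^d}G(x,x,|u(x)|)\,dx$, $\Gamma_{s,G_{:}}(u)=\int_{\mathbb{R}^d}\int_{\mathbb{R}^d}G(x,y,|\delta^s u(x,y)|)\frac{dx\,dy}{|x-y|^d}$. $L^{\hat G_\cdot}(\mathbb{R}^d)$ is the set of measurable $u$ with $\Gamma_{\hat G_\cdot}(u)<\infty$;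 $W^{s,G_{:}}(\mathbb{R}^d)=\{u\in L^{\hat G_\cdot}(\mathbb{R}^d):\Gamma_{s,G_{:}}(u)<\infty\}$, with the norm $\|u\|_{s,G}=\|u\|_G+[u]_{s,G}$, where $\|u\|_G=\inf\{\lambda>0:\Gamma_{\hat G_\cdot}(u/\lambda)\le1\}$ and $[u]_{s,G}=\inf\{\lambda>0:\Gamma_{s,G_{:}}(u/\lambda)\le1\}$. $W^{s,G_{:}}_0(\Omega)$ is the closure of $C_c^\infty(\Omega)$ in $\|\cdot\|_{s,G}$; its elements are extended by $0$ to $\mathbb{R}^d\setminus\Omega$. Its dual is $W^{-s,G_{:}^*}(\Omega)$, with duality pairing $\langle\cdot,\cdot\rangle$. Operator. $\mathcal{L}_g^s:W^{s,G_{:}}_0(\Omega)\to W^{-s,G_{:}^*}(\Omega)$ is $\langle\mathcal{L}_g^su,v\rangle=\int_{\mathbb{R}^d}\int_{\mathbb{R}^d}g(x,y,|\delta^s u(x,y)|)\,\delta^s u(x,y)\,\delta^s v(x,y)\frac{dx\,dy}{|x-y|^d}$. Notation: $v^+=v\vee0$. *)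

theory Defs
  imports "HOL-Analysis.Analysis"
begin

(* Near each boundary point, in suitable orthogonal coordinates with "vertical" unit vector e,
   the set is the strict epigraph of a Lipschitz function of the remaining d - 1 coordinates,
   i.e. of a function on the hyperplane orthogonal to e. *)
definition lipschitz_boundary :: "'a::euclidean_space set \<Rightarrow> bool" where
  "lipschitz_boundary \<Omega> \<longleftrightarrow>
    (\<forall>x0 \<in> frontier \<Omega>. \<exists>\<rho>>0. \<exists>e \<gamma> L. norm e = 1 \<and> L-lipschitz_on {z. z \<bullet> e = 0} \<gamma> \<and>
       \<Omega> \<inter> ball x0 \<rho> = {x \<in> ball x0 \<rho>. \<gamma> (x - (x \<bullet> e) *\<^sub>R e) < x \<bullet> e})"

primrec Ck :: "nat \<Rightarrow> ('a::euclidean_space \<Rightarrow> real) \<Rightarrow> bool" where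
  "Ck 0 f \<longleftrightarrow> continuous_on UNIV f"
| "Ck (Suc k) f \<longleftrightarrow>
     (\<forall>x. f differentiable (at x)) \<and> (\<forall>h. Ck k (\<lambda>x. frechet_derivative f (at x) h))"

definition test_functions :: "'a::euclidean_space set \<Rightarrow> ('a \<Rightarrow> real) set" where
  "test_functions \<Omega> =
    {\<phi>. (\<forall>k. Ck k \<phi>) \<and> compact (closure {x. \<phi> x \<noteq> 0}) \<and> closure {x. \<phi> x \<noteq> 0} \<subseteq> \<Omega>}"

(* For x = y the quotient is 0 by the convention t / 0 = 0; the diagonal is a null set
   in all double integrals below. *)
definition frac_diff :: "real \<Rightarrow> ('a::euclidean_space \<Rightarrow> real) \<Rightarrow> 'a \<Rightarrow> 'a \<Rightarrow> real" where
  "frac_diff s u x y = (u x - u y) / norm (x - y) powr s"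

definition G_of :: "('a \<Rightarrow> 'a \<Rightarrow> real \<Rightarrow> real) \<Rightarrow> 'a \<Rightarrow> 'a \<Rightarrow> real \<Rightarrow> ennreal" where
  "G_of g x y r = (\<integral>\<^sup>+\<rho>\<in>{0..r}. ennreal (\<rho> * g x y \<rho>) \<partial>lborel)"

definition modular_0 ::
  "('a::euclidean_space \<Rightarrow> 'a \<Rightarrow> real \<Rightarrow> real) \<Rightarrow> ('a \<Rightarrow> real) \<Rightarrow> ennreal" where
  "modular_0 g u = (\<integral>\<^sup>+x. G_of g x x \<bar>u x\<bar> \<partial>lebesgue)"

definition modular_s ::
  "real \<Rightarrow> ('a::euclidean_space \<Rightarrow> 'a \<Rightarrow> real \<Rightarrow> real) \<Rightarrow> ('a \<Rightarrow> real) \<Rightarrow> ennreal" where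
  "modular_s s g u =
    (\<integral>\<^sup>+(x, y). G_of g x y \<bar>frac_diff s u x y\<bar> / ennreal (norm (x - y) ^ DIM('a)) \<partial>lebesgue)"

(* Luxemburg functional of a modular; it is infinite if no scaling has modular at most 1. *)
definition luxemburg :: "(('a \<Rightarrow> real) \<Rightarrow> ennreal) \<Rightarrow> ('a \<Rightarrow> real) \<Rightarrow> ennreal" where
  "luxemburg \<Gamma> u = Inf {ennreal l | l. 0 < l \<and> \<Gamma> (\<lambda>x. u x / l) \<le> 1}"

definition norm_sG ::
  "real \<Rightarrow> ('a::euclidean_space \<Rightarrow> 'a \<Rightarrow> real \<Rightarrow> real) \<Rightarrow> ('a \<Rightarrow> real) \<Rightarrow> ennreal" where
  "norm_sG s g u = luxemburg (modular_0 g) u + luxemburg (modular_s s g) u"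

definition L_G :: "('a::euclidean_space \<Rightarrow> 'a \<Rightarrow> real \<Rightarrow> real) \<Rightarrow> ('a \<Rightarrow> real) set" where
  "L_G g = {u \<in> borel_measurable lebesgue. modular_0 g u < \<infinity>}"

definition W_sG ::
  "real \<Rightarrow> ('a::euclidean_space \<Rightarrow> 'a \<Rightarrow> real \<Rightarrow> real) \<Rightarrow> ('a \<Rightarrow> real) set" where
  "W_sG s g = {u \<in> L_G g. modular_s s g u < \<infinity>}"

(* Closure of the test functions in the norm. Elements are functions on the whole space, not
   equivalence classes, so vanishing outside \<Omega> is required almost everywhere only. *)
definition W0_sG ::
  "real \<Rightarrow> ('a::euclidean_space \<Rightarrow> 'a \<Rightarrow> real \<Rightarrow> real) \<Rightarrow> 'a set \<Rightarrow> ('a \<Rightarrow> real) set" where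
  "W0_sG s g \<Omega> =
    {u \<in> W_sG s g. (AE x in lebesgue. x \<notin> \<Omega> \<longrightarrow> u x = 0) \<and>
       (\<forall>\<epsilon>>0. \<exists>\<phi> \<in> test_functions \<Omega>. norm_sG s g (\<lambda>x. u x - \<phi> x) < \<epsilon>)}"

(* frac_op s g u is the functional v \<mapsto> \<langle>L u, v\<rangle>, so the duality pairing is function application. *)
definition frac_op ::
  "real \<Rightarrow> ('a::euclidean_space \<Rightarrow> 'a \<Rightarrow> real \<Rightarrow> real) \<Rightarrow> ('a \<Rightarrow> real) \<Rightarrow> ('a \<Rightarrow> real) \<Rightarrow> real" where
  "frac_op s g u v =
    (LINT (x, y)|lebesgue. g x y \<bar>frac_diff s u x y\<bar> * frac_diff s u x y * frac_diff s v x y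
       / norm (x - y) ^ DIM('a))"

(* (u - v)^+ \<noteq> 0 is meant in the space of functions modulo equality almost everywhere. *)
definition strictly_T_monotone_on ::
  "('a::euclidean_space \<Rightarrow> real) set \<Rightarrow> (('a \<Rightarrow> real) \<Rightarrow> ('a \<Rightarrow> real) \<Rightarrow> real) \<Rightarrow> bool" where
  "strictly_T_monotone_on X A \<longleftrightarrow>
    (\<forall>u \<in> X. \<forall>v \<in> X. \<not> (AE x in lebesgue. max (u x - v x) 0 = 0) \<longrightarrow>
       (A u - A v) (\<lambda>x. max (u x - v x) 0) > 0)"

(* Lipschitz continuity in r is local in (0, \<infinity>), so that powers r^(p-2), 1 < p, are covered.
   Such functions are differentiable almost everywhere, and the bounds on the derivative are
   imposed at almost every r; the differentiability clause only excludes the arbitrary value of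
   deriv at the exceptional points. *)
definition admissible_kernel ::
  "('a::euclidean_space \<Rightarrow> 'a \<Rightarrow> real \<Rightarrow> real) \<Rightarrow> real \<Rightarrow> real \<Rightarrow> bool" where
  "admissible_kernel g g_lo g_up \<longleftrightarrow>
    0 < g_lo \<and> g_lo \<le> g_up \<and>
    (\<forall>x y r. 0 < r \<longrightarrow> 0 < g x y r) \<and>
    (\<lambda>((x, y), r). g x y r) \<in> borel_measurable (lebesgue_on (UNIV \<times> {0<..})) \<and>
    (\<forall>x y a b. 0 < a \<longrightarrow> (\<exists>L. L-lipschitz_on {a..b} (g x y))) \<and>
    (AE (x, y) in lebesgue.
       ((\<lambda>r. r * g x y r) \<longlongrightarrow> 0) (at_right 0) \<and>
       filterlim (\<lambda>r. r * g x y r) at_top at_top \<and>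
       (AE r in lebesgue. 0 < r \<longrightarrow> g x y differentiable (at r) \<and>
          g_lo \<le> r * deriv (g x y) r / g x y r + 1 \<and>
          r * deriv (g x y) r / g x y r + 1 \<le> g_up))"

end

theory Submission
  imports Defs
begin

text \<open>
  The bounds on the logarithmic derivative make \<open>r \<mapsto> r g(x,y,r)\<close> strictly increasing, so the
  integrand of \<open>\<langle>L u - L v, (u - v)\<^sup>+\<rangle>\<close> is nonnegative and vanishes exactly where \<open>(u - v)\<^sup>+\<close> takes
  the same value at \<open>x\<close> and \<open>y\<close>. Monotonicity also gives Young's inequality with constant 1, and
  \<open>r\<^sup>2 g(x,y,r)\<close> is at most a constant times \<open>G(x,y,r)\<close>, so both pairings converge. If their difference
  were 0, then \<open>(u - v)\<^sup>+\<close> would be constant almost everywhere; as it vanishes outside the bounded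
  set \<open>\<Omega>\<close>, the constant would be 0.
\<close>

subsection \<open>Growth of the kernel in its last argument\<close>

text \<open>A Lipschitz map sends the exceptional null set to a null set, so a level \<open>c\<close> between \<open>h b\<close> and \<open>h a\<close>
  outside that image is crossed downwards only at points of differentiability.\<close>

lemma lipschitz_AE_deriv_nonneg_imp_le:
  fixes f :: "real \<Rightarrow> real"
  assumes ab: "a \<le> b" and lip: "L-lipschitz_on {a..b} f"
    and deriv: "AE x in lebesgue. a < x \<and> x < b \<longrightarrow> (\<exists>d\<ge>0. (f has_real_derivative d) (at x))"
  shows "f a \<le> f b"
proof (rule ccontr)
  assume "\<not> f a \<le> f b"
  hence less: "f b < f a" and "a < b" using ab by (auto simp: less_le)
  \<comment> \<open>Half the mean slope of the supposed descent: adding \<open>e * x\<close> makes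
    the nonnegative derivatives positive and still leaves \<open>h b < h a\<close>.\<close>
  define e where "e = (f a - f b) / (2 * (b - a))"
  have e: "e > 0" using less \<open>a < b\<close> by (simp add: e_def)
  define h where "h = (\<lambda>x. f x + e * x)"
  have "e * (b - a) = (f a - f b) / 2"
    unfolding e_def times_divide_eq_left using \<open>a < b\<close> by (subst frac_eq_eq) auto
  hence hab: "h b < h a" using less by (simp add: h_def algebra_simps)
  have liph: "(L + \<bar>e\<bar> * 1)-lipschitz_on {a..b} h"
    unfolding h_def by (intro lipschitz_on_add lip lipschitz_on_cmult_real lipschitz_on_id)
  have cont: "continuous_on {a..b} h" by (rule lipschitz_on_continuous_on[OF liph])
  obtain N where N: "negligible N"
    and der: "\<And>x. x \<notin> N \<Longrightarrow> a < x \<Longrightarrow> x < b \<Longrightarrow> \<exists>d\<ge>0. (f has_real_derivative d) (at x)"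
    using deriv unfolding eventually_ae_filter_negligible by blast
  have "negligible (h ` (N \<inter> {a..b}))"
  proof (rule negligible_locally_Lipschitz_image)
    show "negligible (N \<inter> {a..b})" using N by (rule negligible_subset) auto
    show "\<exists>T B. open T \<and> x \<in> T \<and> (\<forall>y\<in>N \<inter> {a..b} \<inter> T. norm (h y - h x) \<le> B * norm (y - x))"
      if "x \<in> N \<inter> {a..b}" for x
      using lipschitz_on_normD[OF liph] that
      by (intro exI[of _ UNIV] exI[of _ "L + \<bar>e\<bar> * 1"]) auto
  qed simp
  moreover have "\<not> negligible {h b<..<h a}"
    using hab negligible_interval(2)[of "h b" "h a"] by (auto simp: box_real)
  ultimately obtain c where c: "h b < c" "c < h a" "c \<notin> h ` (N \<inter> {a..b})"
    using negligible_subset by (metis (no_types, lifting) greaterThanLessThan_iff subsetI)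
  define S where "S = {t \<in> {a..b}. c \<le> h t}"
  have "closed S"
    using continuous_closed_preimage[OF cont, of "{c..}"] by (simp add: S_def vimage_def Int_def)
  \<comment> \<open>The last point of the interval where \<open>h\<close> is at least
    \<open>c\<close>. There \<open>h x = c\<close>, so \<open>x\<close> avoids \<open>N\<close> by
    the choice of \<open>c\<close>; a positive derivative at \<open>x\<close> then contradicts
    \<open>h\<close> staying below \<open>c\<close> to the right.\<close>
  define x where "x = Sup S"
  have bdd: "bdd_above S" unfolding S_def by (auto intro: bdd_aboveI[of _ b])
  have "a \<in> S" using c \<open>a < b\<close> by (simp add: S_def)
  have "x \<in> S" unfolding x_def using \<open>closed S\<close> bdd \<open>a \<in> S\<close>
    by (intro closed_contains_Sup) auto
  have above: "h t < c" if "x < t" "t \<le> b" for t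
    using that cSup_upper[OF _ bdd, of t] \<open>x \<in> S\<close> unfolding x_def[symmetric] by (force simp: S_def)
  have "x \<noteq> b" using \<open>x \<in> S\<close> c by (auto simp: S_def)
  hence xb: "a \<le> x" "x < b" using \<open>x \<in> S\<close> by (auto simp: S_def)
  have "h x = c"
  proof -
    have "\<exists>t\<ge>x. t \<le> b \<and> h t = c"
      using \<open>x \<in> S\<close> c xb
      by (intro IVT2') (auto simp: S_def intro: continuous_on_subset[OF cont])
    thus ?thesis using above by (metis less_irrefl less_le)
  qed
  hence "x \<noteq> a" "x \<notin> N" using c xb by auto
  then obtain d where d: "d \<ge> 0" "(f has_real_derivative d) (at x)" using der xb by force
  have "(h has_real_derivative d + e) (at x)"
    unfolding h_def using d by (auto intro!: derivative_eq_intros)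
  from DERIV_pos_inc_right[OF this] d e obtain \<delta>
    where \<delta>: "\<delta> > 0" "\<And>k. k > 0 \<Longrightarrow> k < \<delta> \<Longrightarrow> h x < h (x + k)" by auto
  define k where "k = min (\<delta> / 2) (b - x)"
  have "k > 0" "k < \<delta>" "x + k \<le> b" using \<delta> xb by (auto simp: k_def min_def)
  with \<delta>(2)[of k] above[of "x + k"] \<open>h x = c\<close> show False by auto
qed

lemma lipschitz_on_mult_real:
  fixes f h :: "real \<Rightarrow> real"
  assumes f: "L-lipschitz_on {a..b} f" and h: "M-lipschitz_on {a..b} h"
  shows "\<exists>K. K-lipschitz_on {a..b} (\<lambda>x. f x * h x)"
proof -
  have "bounded (f ` {a..b})" "bounded (h ` {a..b})"
    using lipschitz_on_continuous_on[OF f] lipschitz_on_continuous_on[OF h]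
    by (auto intro!: compact_imp_bounded compact_continuous_image)
  then obtain B C where B: "B > 0" "\<And>x. x \<in> {a..b} \<Longrightarrow> \<bar>f x\<bar> \<le> B"
    and C: "C > 0" "\<And>x. x \<in> {a..b} \<Longrightarrow> \<bar>h x\<bar> \<le> C"
    unfolding bounded_pos by auto
  have nn: "0 \<le> L" "0 \<le> M" using f h by (auto dest: lipschitz_on_nonneg)
  have "(B * M + C * L)-lipschitz_on {a..b} (\<lambda>x. f x * h x)"
  proof (rule lipschitz_onI)
    fix x y assume xy: "x \<in> {a..b}" "y \<in> {a..b}"
    have "\<bar>f x * h x - f y * h y\<bar> = \<bar>f x * (h x - h y) + h y * (f x - f y)\<bar>"
      by (simp add: algebra_simps)
    also have "\<dots> \<le> \<bar>f x\<bar> * \<bar>h x - h y\<bar> + \<bar>h y\<bar> * \<bar>f x - f y\<bar>"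
      by (metis abs_mult abs_triangle_ineq)
    also have "\<dots> \<le> B * (M * \<bar>x - y\<bar>) + C * (L * \<bar>x - y\<bar>)"
      using B C xy lipschitz_on_normD[OF f xy] lipschitz_on_normD[OF h xy]
      by (intro add_mono mult_mono) auto
    finally show "dist (f x * h x) (f y * h y) \<le> (B * M + C * L) * dist x y"
      by (simp add: dist_real_def algebra_simps)
  qed (use B C nn in auto)
  thus ?thesis ..
qed

text \<open>The derivative is bounded on the compact interval; \<open>0 < a\<close> keeps away from
  its possible singularity at 0.\<close>

lemma lipschitz_on_powr:
  fixes a b k :: real
  assumes "0 < a"
  shows "\<exists>L. L-lipschitz_on {a..b} (\<lambda>r. r powr k)"
proof -
  have "continuous_on {a..b} (\<lambda>r. k * r powr (k - 1))"
    using assms by (auto intro!: continuous_intros)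
  hence "bounded ((\<lambda>r. k * r powr (k - 1)) ` {a..b})"
    by (auto intro!: compact_imp_bounded compact_continuous_image)
  then obtain B where B: "B > 0" "\<And>r. r \<in> {a..b} \<Longrightarrow> \<bar>k * r powr (k - 1)\<bar> \<le> B"
    unfolding bounded_pos by auto
  have "B-lipschitz_on {a..b} (\<lambda>r. r powr k)"
  proof (rule lipschitz_onI)
    fix x y assume "x \<in> {a..b}" "y \<in> {a..b}"
    moreover have "((\<lambda>r. r powr k) has_field_derivative k * r powr (k - 1)) (at r within {a..b})"
      if "r \<in> {a..b}" for r
      using has_real_derivative_powr[of r k] that assms
      by (auto intro: DERIV_subset)
    ultimately show "dist (x powr k) (y powr k) \<le> B * dist x y"
      using B field_differentiable_bound[of "{a..b}" "\<lambda>r. r powr k" "\<lambda>r. k * r powr (k - 1)" B x y]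
      by (auto simp: dist_norm)
  qed (use B in auto)
  thus ?thesis ..
qed

text \<open>The derivative of \<open>r powr k * f r\<close> is \<open>r powr (k - 1) * f r\<close>
  times \<open>k + r * deriv f r / f r\<close>, so its sign is read off the logarithmic derivative.
  The factor \<open>\<sigma>\<close>, used with values 1 and -1, covers increase and decrease at
  once.\<close>

lemma powr_mult_le_of_AE_log_deriv:
  fixes f :: "real \<Rightarrow> real"
  assumes a: "0 < a" "a \<le> b" and pos: "\<And>r. 0 < r \<Longrightarrow> 0 < f r"
    and lip: "L-lipschitz_on {a..b} f"
    and deriv: "AE r in lebesgue. 0 < r \<longrightarrow>
      f differentiable (at r) \<and> 0 \<le> \<sigma> * (k + r * deriv f r / f r)"
  shows "\<sigma> * (a powr k * f a) \<le> \<sigma> * (b powr k * f b)"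
proof -
  obtain K where "K-lipschitz_on {a..b} (\<lambda>r. r powr k)" using lipschitz_on_powr a by blast
  from lipschitz_on_mult_real[OF this lip] obtain M
    where M: "M-lipschitz_on {a..b} (\<lambda>r. r powr k * f r)" ..
  show ?thesis
  proof (rule lipschitz_AE_deriv_nonneg_imp_le[OF a(2) lipschitz_on_cmult_real[OF M]])
    show "AE r in lebesgue. a < r \<and> r < b \<longrightarrow>
        (\<exists>d\<ge>0. ((\<lambda>r. \<sigma> * (r powr k * f r)) has_real_derivative d) (at r))"
      using deriv
    proof eventually_elim
      case (elim r)
      show ?case
      proof safe
        assume r: "a < r" "r < b"
        hence "0 < r" using a by simp
        have df: "(f has_real_derivative deriv f r) (at r)"
          using elim \<open>0 < r\<close> DERIV_deriv_iff_real_differentiable by blast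
        have "((\<lambda>r. \<sigma> * (r powr k * f r)) has_real_derivative
            \<sigma> * (k * r powr (k - 1) * f r + r powr k * deriv f r)) (at r)"
          by (intro DERIV_cmult) (use DERIV_mult[OF has_real_derivative_powr[OF \<open>0 < r\<close>, of k] df] in \<open>simp add: algebra_simps\<close>)
        moreover have "\<sigma> * (k * r powr (k - 1) * f r + r powr k * deriv f r)
            = r powr (k - 1) * f r * (\<sigma> * (k + r * deriv f r / f r))"
          using pos[OF \<open>0 < r\<close>] \<open>0 < r\<close> by (simp add: powr_diff field_simps)
        moreover have "\<dots> \<ge> 0"
          using elim pos[of r] \<open>0 < r\<close> by (intro mult_nonneg_nonneg[of "r powr (k - 1) * f r"]) auto
        ultimately show "\<exists>d\<ge>0. ((\<lambda>r. \<sigma> * (r powr k * f r)) has_real_derivative d) (at r)"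
          by metis
      qed
    qed
  qed
qed

text \<open>The derivative bounds in integrated form. The lower power gives strict monotonicity of
  \<open>r * f r\<close>, the upper one a doubling condition; no derivative appears
  afterwards.\<close>

definition growth_profile :: "(real \<Rightarrow> real) \<Rightarrow> real \<Rightarrow> real \<Rightarrow> bool" where
  "growth_profile f lo up \<longleftrightarrow> 0 < lo \<and> 0 < up \<and> (\<forall>r>0. 0 < f r) \<and>
     (\<forall>a b. 0 < a \<longrightarrow> a \<le> b \<longrightarrow>
        (b / a) powr lo * (a * f a) \<le> b * f b \<and> b * f b \<le> (b / a) powr up * (a * f a))"

text \<open>The lower bound makes \<open>r powr (1 - lo) * f r\<close> nondecreasing, the upper one
  makes \<open>r powr (1 - up) * f r\<close> nonincreasing; comparing the values at \<open>a\<close>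
  and \<open>b\<close> gives the two power bounds.\<close>

lemma growth_profileI:
  fixes f :: "real \<Rightarrow> real"
  assumes lo: "0 < lo" "lo \<le> up" and pos: "\<And>r. 0 < r \<Longrightarrow> 0 < f r"
    and lip: "\<And>a b. 0 < a \<Longrightarrow> \<exists>L. L-lipschitz_on {a..b} f"
    and deriv: "AE r in lebesgue. 0 < r \<longrightarrow> f differentiable (at r) \<and>
      lo \<le> r * deriv f r / f r + 1 \<and> r * deriv f r / f r + 1 \<le> up"
  shows "growth_profile f lo up"
  unfolding growth_profile_def
proof (intro conjI allI impI)
  fix a b :: real assume a: "0 < a" "a \<le> b"
  obtain L where L: "L-lipschitz_on {a..b} f" using lip a by blast
  have "1 * (a powr (1 - lo) * f a) \<le> 1 * (b powr (1 - lo) * f b)"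
    by (rule powr_mult_le_of_AE_log_deriv[OF a pos L])
      (use deriv in \<open>auto elim!: eventually_mono\<close>)
  thus "(b / a) powr lo * (a * f a) \<le> b * f b"
    using a by (simp add: powr_diff powr_divide field_simps)
  have "(-1) * (a powr (1 - up) * f a) \<le> (-1) * (b powr (1 - up) * f b)"
    by (rule powr_mult_le_of_AE_log_deriv[OF a pos L])
      (use deriv in \<open>auto elim!: eventually_mono\<close>)
  thus "b * f b \<le> (b / a) powr up * (a * f a)"
    using a by (simp add: powr_diff powr_divide field_simps)
qed (use lo pos in auto)

lemma growth_profileD:
  assumes "growth_profile f lo up"
  shows "0 < lo" "0 < up" "0 < r \<Longrightarrow> 0 < f r"
    "0 < a \<Longrightarrow> a \<le> b \<Longrightarrow> (b / a) powr lo * (a * f a) \<le> b * f b"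
    "0 < a \<Longrightarrow> a \<le> b \<Longrightarrow> b * f b \<le> (b / a) powr up * (a * f a)"
  using assms unfolding growth_profile_def by blast+

section \<open>Consequences of power growth: monotonicity, Young's inequality, comparison with the
  primitive\<close>

lemma growth_profile_strict_mono:
  assumes f: "growth_profile f lo up" and ab: "0 \<le> a" "a < b"
  shows "a * f a < b * f b"
proof (cases "a = 0")
  \<comment> \<open>Nothing is known about \<open>f 0\<close>, but here it is multiplied by
    0.\<close>
  case True
  thus ?thesis using growth_profileD(3)[OF f, of b] ab by simp
next
  case False
  hence a: "0 < a" using ab by simp
  have "1 * (a * f a) < (b / a) powr lo * (a * f a)"
  proof (rule mult_strict_right_mono)
    show "1 < (b / a) powr lo"
      using growth_profileD(1)[OF f] a ab by (intro gr_one_powr) auto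
    show "0 < a * f a" using growth_profileD(3)[OF f a] a by simp
  qed
  also have "\<dots> \<le> b * f b" using growth_profileD(4)[OF f a, of b] ab by simp
  finally show ?thesis by simp
qed

lemma growth_profile_mono:
  assumes "growth_profile f lo up" "0 \<le> a" "a \<le> b"
  shows "a * f a \<le> b * f b"
  using growth_profile_strict_mono[OF assms(1,2), of b] assms(3) by (cases "a = b") auto

text \<open>The map is the odd extension of the strictly increasing \<open>r * f r\<close>, hence
  the case distinction by sign.\<close>

lemma growth_profile_flux_strict_mono:
  assumes f: "growth_profile f lo up" and "a < b"
  shows "f \<bar>a\<bar> * a < f \<bar>b\<bar> * b"
proof -
  have nonneg: "0 \<le> r * f r" if "0 \<le> r" for r
    using growth_profile_mono[OF f order_refl that] by simp
  consider "0 \<le> a" | "a < 0" "0 \<le> b" | "b < 0" by linarith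
  thus ?thesis
  proof cases
    case 1
    thus ?thesis using growth_profile_strict_mono[OF f, of a b] \<open>a < b\<close> by (simp add: mult.commute)
  next
    case 2
    thus ?thesis
      using growth_profile_strict_mono[OF f, of 0 "-a"] nonneg[of b] by (simp add: mult.commute)
  next
    case 3
    thus ?thesis
      using growth_profile_strict_mono[OF f, of "-b" "-a"] \<open>a < b\<close> by (simp add: mult.commute)
  qed
qed

text \<open>Whichever of \<open>\<bar>a\<bar>\<close> and \<open>\<bar>b\<bar>\<close> is larger
  replaces the other: by monotonicity of \<open>r * f r\<close> the mixed product is at most one of
  the two pure terms, and the other term is nonnegative.\<close>

lemma growth_profile_young:
  assumes f: "growth_profile f lo up"
  shows "\<bar>f \<bar>a\<bar> * a * b\<bar> \<le> f \<bar>a\<bar> * a * a + f \<bar>b\<bar> * b * b"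
proof -
  have nonneg: "0 \<le> r * f r" if "0 \<le> r" for r
    using growth_profile_mono[OF f order_refl that] by simp
  have eq: "f \<bar>t\<bar> * t * t = (\<bar>t\<bar> * f \<bar>t\<bar>) * \<bar>t\<bar>" for t
    by (simp add: abs_if)
  have "\<bar>f \<bar>a\<bar> * a * b\<bar> = \<bar>\<bar>a\<bar> * f \<bar>a\<bar>\<bar> * \<bar>b\<bar>"
    by (simp add: abs_mult)
  also have "\<dots> = (\<bar>a\<bar> * f \<bar>a\<bar>) * \<bar>b\<bar>" using nonneg[of "\<bar>a\<bar>"] by simp
  also have "\<dots> \<le> (\<bar>a\<bar> * f \<bar>a\<bar>) * \<bar>a\<bar> + (\<bar>b\<bar> * f \<bar>b\<bar>) * \<bar>b\<bar>"
  proof (cases "\<bar>a\<bar> \<le> \<bar>b\<bar>")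
    case True
    have "(\<bar>a\<bar> * f \<bar>a\<bar>) * \<bar>b\<bar> \<le> (\<bar>b\<bar> * f \<bar>b\<bar>) * \<bar>b\<bar>"
      using growth_profile_mono[OF f _ True] by (intro mult_right_mono) auto
    thus ?thesis using nonneg[of "\<bar>a\<bar>"] by (simp add: add_increasing)
  next
    case False
    hence "(\<bar>a\<bar> * f \<bar>a\<bar>) * \<bar>b\<bar> \<le> (\<bar>a\<bar> * f \<bar>a\<bar>) * \<bar>a\<bar>"
      using nonneg[of "\<bar>a\<bar>"] by (intro mult_left_mono) auto
    thus ?thesis using nonneg[of "\<bar>b\<bar>"] by (simp add: add_increasing2)
  qed
  finally show ?thesis by (simp add: eq)
qed

text \<open>Only \<open>{r/2..r}\<close> is kept in the integral. There doubling bounds the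
  integrand below by \<open>r * f r / 2 powr up\<close>, and the length \<open>r / 2\<close>
  supplies the remaining factor.\<close>

lemma growth_profile_le_primitive:
  assumes f: "growth_profile f lo up" and r: "0 \<le> r"
  shows "ennreal (r * f r * r / (2 * 2 powr up)) \<le>
    (\<integral>\<^sup>+\<rho>\<in>{0..r}. ennreal (\<rho> * f \<rho>) \<partial>lborel)"
proof (cases "r = 0")
  case False
  hence r: "0 < r" using r by simp
  have lower: "r * f r / 2 powr up \<le> \<rho> * f \<rho>" if "r / 2 \<le> \<rho>" "\<rho> \<le> r" for \<rho>
  proof -
    have "\<rho> > 0" using that r by simp
    hence "0 < \<rho> * f \<rho>" using growth_profileD(3)[OF f] by simp
    have "r * f r \<le> (r / \<rho>) powr up * (\<rho> * f \<rho>)"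
      using growth_profileD(5)[OF f \<open>\<rho> > 0\<close> that(2)] .
    also have "\<dots> \<le> 2 powr up * (\<rho> * f \<rho>)"
    proof (intro mult_right_mono powr_mono2)
      show "0 \<le> up" using growth_profileD(2)[OF f] by simp
      show "r / \<rho> \<le> 2" using that \<open>\<rho> > 0\<close> by (simp add: field_simps)
    qed (use r \<open>\<rho> > 0\<close> \<open>0 < \<rho> * f \<rho>\<close> in auto)
    finally show ?thesis by (simp add: field_simps)
  qed
  have "0 \<le> r * f r / 2 powr up" using growth_profileD(3)[OF f r] r by simp
  hence "ennreal (r * f r * r / (2 * 2 powr up)) =
      (\<integral>\<^sup>+\<rho>. ennreal (r * f r / 2 powr up) * indicator {r/2..r} \<rho> \<partial>lborel)"
    using r by (subst nn_integral_cmult_indicator) (auto simp: ennreal_mult[symmetric] mult_ac)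
  also have "\<dots> \<le> (\<integral>\<^sup>+\<rho>\<in>{0..r}. ennreal (\<rho> * f \<rho>) \<partial>lborel)"
    using r by (intro nn_integral_mono) (auto simp: indicator_def intro!: ennreal_leI lower)
  finally show ?thesis .
qed simp

subsection \<open>Lebesgue measurability on product spaces\<close>

text \<open>\<open>lebesgue\<close> on a product is not the product of the two
  \<open>lebesgue\<close> measures, so the exceptional set is first covered by a Borel null set, to
  which Fubini for \<open>lborel\<close> applies. Commuting the quantifiers puts the second variable
  outside.\<close>

lemma AE_lebesgue_pair_slices:
  fixes P :: "'a::euclidean_space \<times> 'b::euclidean_space \<Rightarrow> bool"
  assumes "AE z in lebesgue. P z"
  shows "AE y in lebesgue. AE x in lebesgue. P (x, y)"
proof -
  have "AE z in lborel. P z" using assms by (simp add: AE_completion_iff)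
  then obtain N where N: "N \<in> null_sets lborel" "{z. \<not> P z} \<subseteq> N"
    by (auto simp: eventually_ae_filter)
  hence "AE z in lborel \<Otimes>\<^sub>M lborel. z \<notin> N"
    unfolding lborel_prod by (intro AE_not_in)
  hence "AE x in lborel. AE y in lborel. (x, y) \<notin> N"
    by (rule lborel_pair.AE_pair)
  moreover have "{z \<in> space (lborel \<Otimes>\<^sub>M lborel). (fst z, snd z) \<notin> N} \<in> sets (lborel \<Otimes>\<^sub>M lborel)"
    unfolding lborel_prod using null_setsD2[OF N(1)] by (auto simp: set_diff_eq[symmetric] Compl_eq[symmetric])
  ultimately have "AE y in lborel. AE x in lborel. (x, y) \<notin> N"
    by (subst (asm) lborel_pair.AE_commute) auto
  hence "AE y in lborel. AE x in lborel. P (x, y)"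
    using N(2) by (auto elim!: eventually_mono)
  thus ?thesis by (auto simp: AE_completion_iff)
qed

text \<open>The cylinder over a Borel null set is null, because almost every one of its slices is
  empty.\<close>

lemma AE_lebesgue_fst:
  fixes P :: "'a::euclidean_space \<Rightarrow> bool"
  assumes "AE x in lebesgue. P x"
  shows "AE z in (lebesgue :: ('a \<times> 'b::euclidean_space) measure). P (fst z)"
proof -
  have "AE x in lborel. P x" using assms by (simp add: AE_completion_iff)
  then obtain N where N: "N \<in> null_sets lborel" "{x. \<not> P x} \<subseteq> N"
    by (auto simp: eventually_ae_filter)
  have meas: "{z \<in> space (lborel \<Otimes>\<^sub>M (lborel :: 'b measure)). fst z \<notin> N} \<in> sets (lborel \<Otimes>\<^sub>M lborel)"
    using null_setsD2[OF N(1)] by measurable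
  have "AE x in lborel. AE y in (lborel :: 'b measure). fst (x, y) \<notin> N"
    using AE_not_in[OF N(1)] by (auto elim!: eventually_mono)
  from lborel_pair.AE_pair_measure[OF meas this]
  have "AE z in (lborel :: ('a \<times> 'b) measure). fst z \<notin> N" unfolding lborel_prod .
  hence "AE z in (lborel :: ('a \<times> 'b) measure). P (fst z)"
    using N(2) by (auto elim!: eventually_mono)
  thus ?thesis by (rule AE_completion)
qed

lemma AE_lebesgue_snd:
  fixes P :: "'b::euclidean_space \<Rightarrow> bool"
  assumes "AE x in lebesgue. P x"
  shows "AE z in (lebesgue :: ('a::euclidean_space \<times> 'b) measure). P (snd z)"
proof -
  have "AE x in lborel. P x" using assms by (simp add: AE_completion_iff)
  then obtain N where N: "N \<in> null_sets lborel" "{x. \<not> P x} \<subseteq> N"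
    by (auto simp: eventually_ae_filter)
  have meas: "{z \<in> space ((lborel :: 'a measure) \<Otimes>\<^sub>M lborel). snd z \<notin> N} \<in> sets (lborel \<Otimes>\<^sub>M lborel)"
    using null_setsD2[OF N(1)] by measurable
  have "AE x in (lborel :: 'a measure). AE y in lborel. snd (x, y) \<notin> N"
    using AE_not_in[OF N(1)] by (auto elim!: eventually_mono)
  from lborel_pair.AE_pair_measure[OF meas this]
  have "AE z in (lborel :: ('a \<times> 'b) measure). snd z \<notin> N" unfolding lborel_prod .
  hence "AE z in (lborel :: ('a \<times> 'b) measure). P (snd z)"
    using N(2) by (auto elim!: eventually_mono)
  thus ?thesis by (rule AE_completion)
qed

text \<open>Composition with a projection is unproblematic for Borel functions. A Borel
  representative of \<open>u\<close> is therefore composed instead; it changes the result only on a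
  null cylinder.\<close>

lemma borel_measurable_lebesgue_fst:
  fixes u :: "'a::euclidean_space \<Rightarrow> real"
  assumes "u \<in> borel_measurable lebesgue"
  shows "(\<lambda>z :: 'a \<times> 'b::euclidean_space. u (fst z)) \<in> borel_measurable lebesgue"
proof -
  obtain u' where u': "u' \<in> borel_measurable lborel" and eq: "AE x in lborel. u x = u' x"
    using completion_ex_borel_measurable_real[OF assms] by blast
  have "(\<lambda>z :: 'a \<times> 'b. u' (fst z)) \<in> borel_measurable lebesgue"
  proof (rule measurable_completion)
    have "fst \<in> borel_measurable (lborel :: ('a \<times> 'b) measure)"
      by (simp add: borel_measurable_continuous_onI continuous_on_fst)
    moreover have "u' \<in> borel_measurable borel" using u' by simp
    ultimately show "(\<lambda>z :: 'a \<times> 'b. u' (fst z)) \<in> borel_measurable lborel"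
      by (rule measurable_compose)
  qed
  moreover have "AE z in (lebesgue :: ('a \<times> 'b) measure). u' (fst z) = u (fst z)"
    using AE_lebesgue_fst[OF AE_completion[OF eq]] by (auto elim!: eventually_mono)
  ultimately show ?thesis by (rule borel_measurable_AE)
qed

lemma borel_measurable_lebesgue_snd:
  fixes u :: "'b::euclidean_space \<Rightarrow> real"
  assumes "u \<in> borel_measurable lebesgue"
  shows "(\<lambda>z :: 'a::euclidean_space \<times> 'b. u (snd z)) \<in> borel_measurable lebesgue"
proof -
  obtain u' where u': "u' \<in> borel_measurable lborel" and eq: "AE x in lborel. u x = u' x"
    using completion_ex_borel_measurable_real[OF assms] by blast
  have "(\<lambda>z :: 'a \<times> 'b. u' (snd z)) \<in> borel_measurable lebesgue"
  proof (rule measurable_completion)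
    have "snd \<in> borel_measurable (lborel :: ('a \<times> 'b) measure)"
      by (simp add: borel_measurable_continuous_onI continuous_on_snd)
    moreover have "u' \<in> borel_measurable borel" using u' by simp
    ultimately show "(\<lambda>z :: 'a \<times> 'b. u' (snd z)) \<in> borel_measurable lborel"
      by (rule measurable_compose)
  qed
  moreover have "AE z in (lebesgue :: ('a \<times> 'b) measure). u' (snd z) = u (snd z)"
    using AE_lebesgue_snd[OF AE_completion[OF eq]] by (auto elim!: eventually_mono)
  ultimately show ?thesis by (rule borel_measurable_AE)
qed

text \<open>Joint Lebesgue measurability yields measurable slices only at almost every level;
  continuity in \<open>r\<close> reaches each remaining level as a pointwise limit.\<close>

lemma borel_measurable_lebesgue_slice:
  fixes k :: "'a::euclidean_space \<Rightarrow> real \<Rightarrow> real"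
  assumes k: "(\<lambda>(z, r). k z r) \<in> borel_measurable (lebesgue_on (UNIV \<times> {0<..}))"
    and cont: "\<And>z. continuous_on {0<..} (k z)" and r: "0 < r"
  shows "(\<lambda>z. k z r) \<in> borel_measurable lebesgue"
proof -
  define K where "K = (\<lambda>w. if w \<in> UNIV \<times> {0<..} then case w of (z, r) \<Rightarrow> k z r else 0)"
  have "UNIV \<times> {0<..} \<in> sets (lebesgue :: ('a \<times> real) measure)"
    by (intro sets_completionI_sets) (simp add: borel_open open_Times)
  hence "K \<in> borel_measurable lebesgue"
    unfolding K_def using k by (intro borel_measurable_if_I)
  from completion_ex_borel_measurable_real[OF this]
  obtain K' where K': "K' \<in> borel_measurable lborel" and "AE w in lborel. K w = K' w" by blast
  hence "AE w in lebesgue. K' w = K w"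
    by (intro AE_completion) (auto elim!: eventually_mono)
  hence ae: "AE r in lebesgue. AE z in lebesgue. K' (z, r) = K (z, r)"
    by (rule AE_lebesgue_pair_slices)
  have good: "AE r in lebesgue. 0 < r \<longrightarrow> (\<lambda>z. k z r) \<in> borel_measurable lebesgue"
    using ae
  proof eventually_elim
    case (elim r)
    have "(\<lambda>z. K' (z, r)) \<in> borel_measurable lebesgue"
    proof (rule measurable_completion)
      have "(\<lambda>z :: 'a. (z, r)) \<in> borel_measurable lborel"
        by (simp add: borel_measurable_continuous_onI continuous_on_Pair)
      moreover have "K' \<in> borel_measurable borel" using K' by simp
      ultimately show "(\<lambda>z. K' (z, r)) \<in> borel_measurable lborel"
        by (rule measurable_compose)
    qed
    hence "(\<lambda>z. K (z, r)) \<in> borel_measurable lebesgue"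
      using elim by (rule borel_measurable_AE)
    thus ?case by (auto simp: K_def)
  qed
  then obtain N where N: "negligible N"
    "\<And>r. r \<notin> N \<Longrightarrow> 0 < r \<Longrightarrow> (\<lambda>z. k z r) \<in> borel_measurable lebesgue"
    unfolding eventually_ae_filter_negligible by blast
  \<comment> \<open>The exceptional levels are null, so they cannot fill an interval to the right of
    \<open>r\<close>; this gives good levels converging to \<open>r\<close>.\<close>
  have "\<exists>q. r < q \<and> q < r + 1 / Suc n \<and> q \<notin> N" for n
  proof (rule ccontr)
    assume "\<not> ?thesis"
    hence "{r<..<r + 1 / Suc n} \<subseteq> N" by auto
    hence "negligible {r<..<r + 1 / Suc n}" using N negligible_subset by blast
    thus False using negligible_interval(2)[of r "r + 1 / Suc n"] by (auto simp: box_real)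
  qed
  then obtain q where q: "\<And>n. r < q n" "\<And>n. q n < r + 1 / Suc n" "\<And>n. q n \<notin> N" by metis
  have "q \<longlonglongrightarrow> r"
  proof (rule tendsto_sandwich[of "\<lambda>_. r" _ _ "\<lambda>n. r + 1 / Suc n"])
    show "(\<lambda>n. r + 1 / Suc n) \<longlonglongrightarrow> r"
      using tendsto_add[OF tendsto_const LIMSEQ_inverse_real_of_nat, of r] by (simp add: inverse_eq_divide)
  qed (use q in \<open>auto intro!: always_eventually less_imp_le\<close>)
  show ?thesis
  proof (rule borel_measurable_LIMSEQ_real)
    fix z
    have "isCont (k z) r" using cont r by (simp add: continuous_on_eq_continuous_at)
    thus "(\<lambda>n. k z (q n)) \<longlonglongrightarrow> k z r" using \<open>q \<longlonglongrightarrow> r\<close> by (rule isCont_tendsto_compose)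
  next
    fix n
    have "0 < q n" using q(1)[of n] r by linarith
    thus "(\<lambda>z. k z (q n)) \<in> borel_measurable lebesgue" using N(2) q(3) by blast
  qed
qed

text \<open>\<open>h\<close> is approximated by functions with countably many values. For these the
  composition is measurable piece by piece, and continuity in the second argument passes to the
  limit.\<close>

lemma borel_measurable_caratheodory:
  fixes k :: "'a \<Rightarrow> real \<Rightarrow> real"
  assumes k: "\<And>r. 0 < r \<Longrightarrow> (\<lambda>z. k z r) \<in> borel_measurable M"
    and cont: "\<And>z. continuous_on {0<..} (k z)"
    and h[measurable]: "h \<in> borel_measurable M" and pos: "\<And>z. 0 < h z"
  shows "(\<lambda>z. k z (h z)) \<in> borel_measurable M"
proof (rule borel_measurable_LIMSEQ_real)
  \<comment> \<open>The approximation uses \<open>Suc (?i n z)\<close>, thus rounding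
    \<open>h\<close> upwards on the grid of mesh \<open>1 / Suc n\<close>. Plain rounding down could
    give 0, where neither measurability nor continuity of \<open>k\<close> is assumed.\<close>
  let ?i = "\<lambda>n z. nat \<lfloor>real (Suc n) * h z\<rfloor>"
  fix n
  show "(\<lambda>z. k z (real (Suc (?i n z)) / real (Suc n))) \<in> borel_measurable M"
  proof (rule measurable_compose_countable[where f = "\<lambda>i z. k z (real (Suc i) / real (Suc n))"])
    show "(\<lambda>z. k z (real (Suc i) / real (Suc n))) \<in> borel_measurable M" for i by (intro k) auto
    show "?i n \<in> M \<rightarrow>\<^sub>M count_space UNIV" by measurable
  qed
next
  fix z
  let ?q = "\<lambda>n. real (Suc (nat \<lfloor>real (Suc n) * h z\<rfloor>)) / real (Suc n)"
  have q: "h z \<le> ?q n" "?q n \<le> h z + 1 / Suc n" for n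
  proof -
    have "0 \<le> real (Suc n) * h z" using pos[of z] by simp
    hence "real (Suc (nat \<lfloor>real (Suc n) * h z\<rfloor>)) = real_of_int \<lfloor>real (Suc n) * h z\<rfloor> + 1" by simp
    moreover have "real_of_int \<lfloor>real (Suc n) * h z\<rfloor> \<le> real (Suc n) * h z"
      "real (Suc n) * h z \<le> real_of_int \<lfloor>real (Suc n) * h z\<rfloor> + 1" by linarith+
    ultimately show "h z \<le> ?q n" "?q n \<le> h z + 1 / Suc n"
      by (simp_all only: pos_le_divide_eq pos_divide_le_eq of_nat_0_less_iff zero_less_Suc)
        (simp_all add: distrib_left distrib_right mult_ac)
  qed
  have "?q \<longlonglongrightarrow> h z"
  proof (rule tendsto_sandwich[of "\<lambda>_. h z" _ _ "\<lambda>n. h z + 1 / Suc n"])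
    show "(\<lambda>n. h z + 1 / Suc n) \<longlonglongrightarrow> h z"
      using tendsto_add[OF tendsto_const LIMSEQ_inverse_real_of_nat, of "h z"]
      by (simp add: inverse_eq_divide)
  qed (use q in \<open>auto intro!: always_eventually\<close>)
  with _ show "(\<lambda>n. k z (?q n)) \<longlonglongrightarrow> k z (h z)"
  proof (rule isCont_tendsto_compose)
    show "isCont (k z) (h z)" using cont pos by (simp add: continuous_on_eq_continuous_at)
  qed
qed

subsection \<open>The fractional operator\<close>

lemma admissible_kernel_AE_growth_profile:
  fixes g :: "'a::euclidean_space \<Rightarrow> 'a \<Rightarrow> real \<Rightarrow> real"
  assumes "admissible_kernel g lo up"
  shows "AE z in lebesgue. growth_profile (g (fst z) (snd z)) lo up"
proof -
  have g: "0 < lo" "lo \<le> up" "\<And>x y r. 0 < r \<Longrightarrow> 0 < g x y r"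
    "\<And>x y a b. 0 < a \<Longrightarrow> \<exists>L. L-lipschitz_on {a..b} (g x y)"
    "AE (x, y) in lebesgue. AE r in lebesgue. 0 < r \<longrightarrow> g x y differentiable (at r) \<and>
       lo \<le> r * deriv (g x y) r / g x y r + 1 \<and> r * deriv (g x y) r / g x y r + 1 \<le> up"
    using assms unfolding admissible_kernel_def by (auto elim!: eventually_mono)
  from g(5) show ?thesis
  proof eventually_elim
    case (elim z)
    show ?case
    proof (rule growth_profileI)
      show "AE r in lebesgue. 0 < r \<longrightarrow> g (fst z) (snd z) differentiable (at r) \<and>
        lo \<le> r * deriv (g (fst z) (snd z)) r / g (fst z) (snd z) r + 1 \<and>
        r * deriv (g (fst z) (snd z)) r / g (fst z) (snd z) r + 1 \<le> up"
        using elim by (simp add: case_prod_beta)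
    qed (fact g)+
  qed
qed

text \<open>The local Lipschitz condition gives continuity on the open half-line, so the two
  preceding results apply; \<open>h\<close> stays positive because the regularity of
  \<open>g\<close> is only assumed for \<open>0 < r\<close>.\<close>

lemma admissible_kernel_measurable_compose:
  fixes g :: "'a::euclidean_space \<Rightarrow> 'a \<Rightarrow> real \<Rightarrow> real"
  assumes g: "admissible_kernel g lo up"
    and h: "h \<in> borel_measurable lebesgue" "\<And>z. 0 < h z"
  shows "(\<lambda>z. g (fst z) (snd z) (h z)) \<in> borel_measurable lebesgue"
proof -
  have cont: "continuous_on {0<..} (g (fst z) (snd z))" for z
    unfolding continuous_on_eq_continuous_at[OF open_greaterThan]
  proof
    fix r :: real assume "r \<in> {0<..}"
    hence r: "0 < r" by simp
    obtain L where "L-lipschitz_on {r/2..2*r} (g (fst z) (snd z))"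
      using g r unfolding admissible_kernel_def by (metis half_gt_zero)
    hence "continuous_on {r/2..2*r} (g (fst z) (snd z))" by (rule lipschitz_on_continuous_on)
    thus "isCont (g (fst z) (snd z)) r"
      by (rule continuous_on_interior) (use r in auto)
  qed
  have "(\<lambda>(z, r). g (fst z) (snd z) r) \<in> borel_measurable (lebesgue_on (UNIV \<times> {0<..}))"
    using g unfolding admissible_kernel_def by (simp add: case_prod_beta')
  hence "(\<lambda>z. g (fst z) (snd z) r) \<in> borel_measurable lebesgue" if "0 < r" for r
    using cont that by (rule borel_measurable_lebesgue_slice)
  thus ?thesis using cont h by (rule borel_measurable_caratheodory)
qed

section \<open>The integrand of the pairing: measurability and integrability\<close>

definition flux_density ::
  "real \<Rightarrow> ('a::euclidean_space \<Rightarrow> 'a \<Rightarrow> real \<Rightarrow> real) \<Rightarrow> ('a \<Rightarrow> real) \<Rightarrow> ('a \<Rightarrow> real) \<Rightarrow> 'a \<times> 'a \<Rightarrow> real" where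
  "flux_density s g u v z =
    g (fst z) (snd z) \<bar>frac_diff s u (fst z) (snd z)\<bar> * frac_diff s u (fst z) (snd z)
      * frac_diff s v (fst z) (snd z) / norm (fst z - snd z) ^ DIM('a)"

lemma frac_op_eq: "frac_op s g u v = integral\<^sup>L lebesgue (flux_density s g u v)"
  unfolding frac_op_def flux_density_def[abs_def] case_prod_beta' ..

lemma norm_diff_borel_measurable:
  "(\<lambda>z :: 'a::euclidean_space \<times> 'a. norm (fst z - snd z)) \<in> borel_measurable lebesgue"
proof (rule measurable_completion)
  have "continuous_on UNIV (\<lambda>z :: 'a::euclidean_space \<times> 'a. norm (fst z - snd z))" by (intro continuous_intros)
  thus "(\<lambda>z :: 'a::euclidean_space \<times> 'a. norm (fst z - snd z)) \<in> borel_measurable lborel"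
   by (simp add: borel_measurable_continuous_onI)
qed
lemma frac_diff_borel_measurable:
  fixes u :: "'a::euclidean_space \<Rightarrow> real"
  assumes u: "u \<in> borel_measurable lebesgue"
  shows "(\<lambda>z. frac_diff s u (fst z) (snd z)) \<in> borel_measurable lebesgue"
proof -
  have num: "(\<lambda>z :: 'a \<times> 'a. u (fst z) - u (snd z)) \<in> borel_measurable lebesgue"
    using borel_measurable_lebesgue_fst[OF u] borel_measurable_lebesgue_snd[OF u]
    by (rule borel_measurable_diff)
  have den: "(\<lambda>z :: 'a \<times> 'a. norm (fst z - snd z) powr s) \<in> borel_measurable lebesgue"
    using norm_diff_borel_measurable by (rule powr_real_measurable) simp
  show ?thesis unfolding frac_diff_def using num den by (rule borel_measurable_divide)
qed

lemma flux_density_borel_measurable: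
  fixes g :: "'a::euclidean_space \<Rightarrow> 'a \<Rightarrow> real \<Rightarrow> real"
  assumes g: "admissible_kernel g lo up"
    and u: "u \<in> borel_measurable lebesgue" and v: "v \<in> borel_measurable lebesgue"
  shows "flux_density s g u v \<in> borel_measurable lebesgue"
proof -
  let ?\<delta> = "\<lambda>u z. frac_diff s u (fst z) (snd z)"
  note [measurable] = frac_diff_borel_measurable[OF u, of s] frac_diff_borel_measurable[OF v, of s]
    norm_diff_borel_measurable
  \<comment> \<open>The value of \<open>g\<close> at \<open>r = 0\<close> is arbitrary, but it is always multiplied by \<open>0\<close>.\<close>
  define h where "h = (\<lambda>z. if ?\<delta> u z = 0 then 1 else \<bar>?\<delta> u z\<bar>)"
  have "h \<in> borel_measurable lebesgue" unfolding h_def by measurable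
  moreover have "0 < h z" for z by (simp add: h_def)
  ultimately have [measurable]: "(\<lambda>z. g (fst z) (snd z) (h z)) \<in> borel_measurable lebesgue"
    by (rule admissible_kernel_measurable_compose[OF g])
  have "flux_density s g u v = (\<lambda>z. g (fst z) (snd z) (h z) * ?\<delta> u z * ?\<delta> v z
      / norm (fst z - snd z) ^ DIM('a))"
    by (auto simp: fun_eq_iff flux_density_def h_def)
  thus ?thesis by simp
qed

lemma flux_density_young:
  assumes "growth_profile (g (fst z) (snd z)) lo up"
  shows "\<bar>flux_density s g u v z\<bar> \<le> flux_density s g u u z + flux_density s g v v z"
  using divide_right_mono[OF growth_profile_young[OF assms, of "frac_diff s u (fst z) (snd z)"
      "frac_diff s v (fst z) (snd z)"], of "norm (fst z - snd z) ^ DIM('a)"]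
  by (simp add: flux_density_def abs_divide add_divide_distrib)

text \<open>Young's inequality with \<open>v = u\<close> bounds the absolute value by twice the
  quantity itself.\<close>

lemma flux_density_diag_nonneg:
  assumes "growth_profile (g (fst z) (snd z)) lo up"
  shows "0 \<le> flux_density s g u u z"
  using flux_density_young[where g = g and z = z, OF assms, of s u u] by linarith

lemma flux_density_diag_integrable:
  fixes g :: "'a::euclidean_space \<Rightarrow> 'a \<Rightarrow> real \<Rightarrow> real"
  assumes g: "admissible_kernel g lo up" and u: "u \<in> W_sG s g"
  shows "integrable lebesgue (flux_density s g u u)"
proof -
  \<comment> \<open>The constant of \<open>growth_profile_le_primitive\<close>: the integrand
    divided by \<open>C\<close> lies below that of the modular.\<close>
  define C where "C = 2 * 2 powr up"
  have C: "C > 0" by (simp add: C_def)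
  have um: "u \<in> borel_measurable lebesgue" and fin: "modular_s s g u < \<infinity>"
    using u by (auto simp: W_sG_def L_G_def)
  note ae = admissible_kernel_AE_growth_profile[OF g]
  have "(\<integral>\<^sup>+z. ennreal (flux_density s g u u z / C) \<partial>lebesgue) \<le> modular_s s g u"
    unfolding modular_s_def
  proof (rule nn_integral_mono_AE, use ae in eventually_elim)
    case (elim z)
    obtain x y where z: "z = (x, y)" by (cases z)
    let ?a = "frac_diff s u x y" and ?n = "norm (x - y) ^ DIM('a)"
    have f: "growth_profile (g x y) lo up" using elim z by simp
    show ?case
    proof (cases "x = y")
      \<comment> \<open>On the diagonal the left side is 0. Off it \<open>?n\<close> is positive, as
        needed to turn the real quotient into an \<open>ennreal\<close> quotient, since the two
        divisions by 0 differ.\<close>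
      case True
      thus ?thesis by (simp add: z flux_density_def frac_diff_def)
    next
      case False
      have nonneg: "0 \<le> \<bar>?a\<bar> * g x y \<bar>?a\<bar>"
        using growth_profile_mono[OF f order_refl, of "\<bar>?a\<bar>"] by simp
      have sq: "g x y \<bar>?a\<bar> * ?a * ?a = \<bar>?a\<bar> * g x y \<bar>?a\<bar> * \<bar>?a\<bar>"
        by (simp add: abs_if)
      have "flux_density s g u u z / C = (\<bar>?a\<bar> * g x y \<bar>?a\<bar> * \<bar>?a\<bar> / C) / ?n"
        unfolding flux_density_def z fst_conv snd_conv sq by simp
      hence "ennreal (flux_density s g u u z / C) = ennreal (\<bar>?a\<bar> * g x y \<bar>?a\<bar> * \<bar>?a\<bar> / C) / ennreal ?n"
        using False C nonneg by (simp add: divide_ennreal)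
      also have "\<dots> \<le> G_of g x y \<bar>?a\<bar> / ennreal ?n"
        unfolding G_of_def C_def
        by (intro divide_right_mono_ennreal growth_profile_le_primitive[OF f]) auto
      finally show ?thesis by (simp add: z)
    qed
  qed
  hence "(\<integral>\<^sup>+z. ennreal (flux_density s g u u z / C) \<partial>lebesgue) < \<infinity>"
    using fin by (rule le_less_trans)
  moreover have "AE z in lebesgue. 0 \<le> flux_density s g u u z / C"
    using ae
  proof eventually_elim
    case (elim z)
    thus ?case using C flux_density_diag_nonneg[where g = g and z = z, OF elim] by simp
  qed
  ultimately have "integrable lebesgue (\<lambda>z. flux_density s g u u z / C)"
    using flux_density_borel_measurable[OF g um um]
    by (intro integrableI_nonneg borel_measurable_divide) auto
  hence "integrable lebesgue (\<lambda>z. C * (flux_density s g u u z / C))"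
    by (intro integrable_mult_right)
  thus ?thesis using C by simp
qed

text \<open>The increment bound stands in for membership of \<open>w\<close> in \<open>W_sG\<close>:
  the mixed term is dominated through the increments of \<open>u\<close> and \<open>v\<close>, whose
  diagonal terms are integrable.\<close>

lemma flux_density_integrable:
  fixes g :: "'a::euclidean_space \<Rightarrow> 'a \<Rightarrow> real \<Rightarrow> real"
  assumes g: "admissible_kernel g lo up" and u: "u \<in> W_sG s g" and v: "v \<in> W_sG s g"
    and w: "w \<in> borel_measurable lebesgue" "\<And>x y. \<bar>w x - w y\<bar> \<le> \<bar>u x - u y\<bar> + \<bar>v x - v y\<bar>"
  shows "integrable lebesgue (flux_density s g u w)"
proof (rule Bochner_Integration.integrable_bound)
  let ?F = "flux_density s g"
  \<comment> \<open>One \<open>?F u u\<close> comes from the increment of \<open>u\<close>; the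
    other and \<open>?F v v\<close> come from Young's inequality applied to
    \<open>?F u v\<close>.\<close>
  show "integrable lebesgue (\<lambda>z. 2 * ?F u u z + ?F v v z)"
    using flux_density_diag_integrable[OF g u] flux_density_diag_integrable[OF g v] by auto
  have "u \<in> borel_measurable lebesgue" using u by (simp add: W_sG_def L_G_def)
  thus "?F u w \<in> borel_measurable lebesgue"
    using flux_density_borel_measurable g w(1) by blast
  have split: "\<bar>?F u w z\<bar> \<le> \<bar>?F u u z\<bar> + \<bar>?F u v z\<bar>" for z
  proof -
    obtain x y where z: "z = (x, y)" by (cases z)
    let ?c = "\<bar>g x y \<bar>frac_diff s u x y\<bar> * frac_diff s u x y\<bar> / (norm (x - y) powr s * norm (x - y) ^ DIM('a))"
    have eq: "\<bar>?F u q z\<bar> = ?c * \<bar>q x - q y\<bar>" for q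
      by (simp add: flux_density_def z frac_diff_def[of s q] abs_mult abs_divide)
    have "?c * \<bar>w x - w y\<bar> \<le> ?c * (\<bar>u x - u y\<bar> + \<bar>v x - v y\<bar>)"
      by (intro mult_left_mono w) auto
    thus ?thesis unfolding eq by (simp add: distrib_left)
  qed
  show "AE z in lebesgue. norm (?F u w z) \<le> norm (2 * ?F u u z + ?F v v z)"
    using admissible_kernel_AE_growth_profile[OF g]
  proof eventually_elim
    case (elim z)
    have "0 \<le> ?F u u z" "0 \<le> ?F v v z" by (rule flux_density_diag_nonneg[where g = g and z = z, OF elim])+
    thus ?case using split[of z] flux_density_young[where g = g and z = z, OF elim, of s u v] by simp
  qed
qed

section \<open>Strict positivity of the difference\<close>

text \<open>If \<open>w x > w y\<close>, then \<open>w x > 0\<close>, so \<open>u - v\<close> equals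
  \<open>w\<close> at \<open>x\<close> and is at most \<open>w\<close> at \<open>y\<close>; hence
  \<open>u - v\<close> increases strictly along with \<open>w\<close>. By strict monotonicity the
  flux difference has the same strict sign as the increment of \<open>w\<close>.\<close>

lemma flux_density_diff_pos:
  fixes g :: "'a::euclidean_space \<Rightarrow> 'a \<Rightarrow> real \<Rightarrow> real" and u v :: "'a \<Rightarrow> real"
  defines "w \<equiv> \<lambda>x. max (u x - v x) 0"
  assumes f: "growth_profile (g (fst z) (snd z)) lo up"
    and neq: "w (fst z) \<noteq> w (snd z)"
  shows "flux_density s g v w z < flux_density s g u w z"
proof -
  obtain x y where z: "z = (x, y)" by (cases z)
  let ?\<delta> = "\<lambda>q. frac_diff s q x y" and ?n = "norm (x - y) ^ DIM('a)"
  let ?A = "\<lambda>t. g x y \<bar>t\<bar> * t"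
  have f: "growth_profile (g x y) lo up" and neq: "w x \<noteq> w y" using f neq z by auto
  hence "x \<noteq> y" by auto
  hence n: "0 < ?n" "0 < norm (x - y) powr s" by auto
  have "0 < (?A (?\<delta> u) - ?A (?\<delta> v)) * ?\<delta> w"
  proof (cases "w x > w y")
    case True
    hence "u x - u y > v x - v y" by (auto simp: w_def max_def split: if_splits)
    hence "?\<delta> v < ?\<delta> u" using n by (simp add: frac_diff_def divide_strict_right_mono)
    moreover have "?\<delta> w > 0" using True n by (simp add: frac_diff_def)
    ultimately show ?thesis
      using growth_profile_flux_strict_mono[OF f, of "?\<delta> v" "?\<delta> u"] by simp
  next
    case False
    hence less: "w x < w y" using neq by simp
    hence "u x - u y < v x - v y" by (auto simp: w_def max_def split: if_splits)
    hence "?\<delta> u < ?\<delta> v" using n by (simp add: frac_diff_def divide_strict_right_mono)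
    moreover have "?\<delta> w < 0" using less n by (simp add: frac_diff_def divide_neg_pos)
    ultimately show ?thesis
      using growth_profile_flux_strict_mono[OF f, of "?\<delta> u" "?\<delta> v"] by (simp add: mult_neg_neg)
  qed
  hence "0 < (?A (?\<delta> u) - ?A (?\<delta> v)) * ?\<delta> w / ?n" using n by simp
  thus ?thesis by (simp add: flux_density_def z left_diff_distrib diff_divide_distrib)
qed

lemma flux_density_const:
  assumes "w (fst z) = w (snd z)"
  shows "flux_density s g u w z = 0"
  using assms by (simp add: flux_density_def frac_diff_def)

text \<open>The complement of a bounded set contains the complement of a ball, a nonempty open set,
  which no null set can contain.\<close>

lemma bounded_AE_ex_outside:
  fixes \<Omega> :: "'a::euclidean_space set"
  assumes "bounded \<Omega>" and "AE x in lebesgue. P x"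
  shows "\<exists>x. x \<notin> \<Omega> \<and> P x"
proof (rule ccontr)
  assume contra: "\<not> ?thesis"
  obtain R where R: "\<Omega> \<subseteq> cball 0 R"
    using assms(1) by (auto simp: bounded_iff subset_eq)
  obtain N where "negligible N" "\<And>x. x \<notin> N \<Longrightarrow> P x"
    using assms(2) unfolding eventually_ae_filter_negligible by blast
  hence "- cball 0 R \<subseteq> N" using contra R by blast
  hence "negligible (- cball (0::'a) R)" using \<open>negligible N\<close> negligible_subset by blast
  moreover have "open (- cball (0::'a) R)" by (simp add: open_Compl)
  moreover have "- cball (0::'a) R \<noteq> {}"
    using bounded_cball[of "0::'a" R] not_bounded_UNIV[where 'a='a] by (metis Compl_UNIV_eq double_compl)
  ultimately show False using open_not_negligible by blast
qed

theorem theorem3p1: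
  fixes \<Omega> :: "'a::euclidean_space set"
    and g :: "'a \<Rightarrow> 'a \<Rightarrow> real \<Rightarrow> real"
    and s g_lo g_up :: real
  assumes "0 < s" and "s < 1"
    and "open \<Omega>" and "connected \<Omega>" and "\<Omega> \<noteq> {}" and "bounded \<Omega>"
    and "lipschitz_boundary \<Omega>"
    and "admissible_kernel g g_lo g_up"
  shows "strictly_T_monotone_on (W0_sG s g \<Omega>) (frac_op s g)"
  unfolding strictly_T_monotone_on_def
proof (intro ballI impI)
  fix u v assume "u \<in> W0_sG s g \<Omega>" "v \<in> W0_sG s g \<Omega>"
  hence u: "u \<in> W_sG s g" and v: "v \<in> W_sG s g"
    and outside: "AE x in lebesgue. x \<notin> \<Omega> \<longrightarrow> u x = 0" "AE x in lebesgue. x \<notin> \<Omega> \<longrightarrow> v x = 0"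
    by (auto simp: W0_sG_def)
  define w where "w = (\<lambda>x. max (u x - v x) 0)"
  assume "\<not> (AE x in lebesgue. max (u x - v x) 0 = 0)"
  hence nonzero: "\<not> (AE x in lebesgue. w x = 0)" by (simp add: w_def)
  note g = assms(8)
  let ?F = "flux_density s g"
  have "u \<in> borel_measurable lebesgue" "v \<in> borel_measurable lebesgue"
    using u v by (auto simp: W_sG_def L_G_def)
  hence wm: "w \<in> borel_measurable lebesgue" unfolding w_def by measurable
  have "integrable lebesgue (?F u w)" "integrable lebesgue (?F v w)"
    by (rule flux_density_integrable[OF g u v wm], force simp: w_def)
      (rule flux_density_integrable[OF g v u wm], force simp: w_def)
  note int = this
  \<comment> \<open>Where \<open>w\<close> takes different values at the two points the difference
    is positive; where the values agree both integrands vanish.\<close>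
  have nonneg: "AE z in lebesgue. 0 \<le> ?F u w z - ?F v w z"
    using admissible_kernel_AE_growth_profile[OF g]
  proof eventually_elim
    case (elim z)
    show ?case
      using flux_density_diff_pos[where g = g and z = z, OF elim, of u v s] flux_density_const[of w z s g]
      unfolding w_def by fastforce
  qed
  have diff: "frac_op s g u w - frac_op s g v w = (LINT z|lebesgue. ?F u w z - ?F v w z)"
    using int by (simp add: frac_op_eq)
  have "(LINT z|lebesgue. ?F u w z - ?F v w z) \<noteq> 0"
  proof
    assume "(LINT z|lebesgue. ?F u w z - ?F v w z) = 0"
    hence "AE z in lebesgue. ?F u w z - ?F v w z = 0"
      using int nonneg by (subst (asm) integral_nonneg_eq_0_iff_AE) auto
    with admissible_kernel_AE_growth_profile[OF g]
    have "AE z in lebesgue. w (fst z) = w (snd z)"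
    proof eventually_elim
      case (elim z)
      thus ?case using flux_density_diff_pos[where g = g and z = z, OF elim(1), of u v s] unfolding w_def by fastforce
    qed
    \<comment> \<open>Fixing \<open>y\<close> first shows that \<open>w\<close> equals the constant
      \<open>w y\<close> almost everywhere, for almost every \<open>y\<close>.\<close>
    from AE_lebesgue_pair_slices[OF this]
    have "AE y in lebesgue. AE x in lebesgue. w x = w y" by simp
    with outside have "AE y in lebesgue. (y \<notin> \<Omega> \<longrightarrow> w y = 0) \<and> (AE x in lebesgue. w x = w y)"
      by eventually_elim (auto simp: w_def)
    \<comment> \<open>A suitable \<open>y\<close> outside \<open>\<Omega>\<close> identifies this
      constant as 0.\<close>
    from bounded_AE_ex_outside[OF \<open>bounded \<Omega>\<close> this] obtain y
      where "w y = 0" "AE x in lebesgue. w x = w y" by blast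
    with nonzero show False by simp
  qed
  moreover have "(LINT z|lebesgue. ?F u w z - ?F v w z) \<ge> 0"
    using nonneg by (rule integral_nonneg_AE)
  ultimately show "(frac_op s g u - frac_op s g v) (\<lambda>x. max (u x - v x) 0) > 0"
    using diff unfolding w_def by simp
qed

end
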